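(* Let $\mu_1,\mu_2$ be two Borel probability measures on a Polish space $\mathcal X$ and let $T:\mathcal X\to\mathcal X$ be an invertible Borel measurable map such that the pushforward $T^*\mu_1$ is equivalent to $\mu_2$ (mutually absolutely continuous). Define $\beta:\mathcal X\times\mathcal X\to[0,1]$ by $$\beta(u,v):=1\wedge\frac{dT^*\mu_1}{d\mu_2}(u)\,\frac{d\mu_2}{dT^*\mu_1}(v).$$ Then the probability measure on $\mathcal X\times\mathcal X$ $$\pi_\beta(du,dv)=\int_{w\in\mathcal X}\big[\beta(w,T(u))\,\delta_{T(u)}(dv)+(1-\beta(w,T(u)))\,\delta_w(dv)\big]\,\mu_1(du)\,\mu_2(dw)$$ is a coupling of $\mu_1$ and $\mu_2$, i.e. its first marginal is $\mu_1$ and its second marginal is $\mu_2$.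
   Context: $T^*\mu_1$ denotes the pushforward measure $T^*\mu_1(A)=\mu_1(T^{-1}(A))$. $\delta_a$ is the Dirac measure at $a$. The integral defining $\pi_\beta$ is over $w$. *)

theory Defs
  imports "HOL-Probability.Probability"
begin

definition equivalent_measures :: "'a measure \<Rightarrow> 'a measure \<Rightarrow> bool" where
  "equivalent_measures M N \<longleftrightarrow>
     sets M = sets N \<and> absolutely_continuous M N \<and> absolutely_continuous N M"

definition coupling :: "('a \<times> 'b) measure \<Rightarrow> 'a measure \<Rightarrow> 'b measure \<Rightarrow> bool" where
  "coupling P M N \<longleftrightarrow>
     prob_space P \<and> sets P = sets (M \<Otimes>\<^sub>M N) \<and> distr P M fst = M \<and> distr P N snd = N"

text \<open>\<^term>\<open>RN_deriv M N\<close> is the derivative \<open>dN / dM\<close>: its first argument is the reference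
  measure. It is a version with values in \<^typ>\<open>ennreal\<close>; it may be \<open>\<infinity>\<close> on a null set, where the
  truncation at 1 still applies.\<close>

definition acceptance :: "('a::topological_space) measure \<Rightarrow> 'a measure \<Rightarrow> ('a \<Rightarrow> 'a) \<Rightarrow> 'a \<Rightarrow> 'a \<Rightarrow> ennreal" where
  "acceptance \<mu>1 \<mu>2 T u v =
     min 1 (RN_deriv \<mu>2 (distr \<mu>1 borel T) u * RN_deriv (distr \<mu>1 borel T) \<mu>2 v)"

text \<open>The measure is given by its value on a measurable set \<open>C\<close>: the Dirac measures in the second
  variable are evaluated at the section of \<open>C\<close> over \<open>u\<close>. Should this set function fail to be a
  measure, \<^const>\<open>measure_of\<close> would yield the zero measure, which is not a coupling.\<close>

definition coupling_measure :: "('a::topological_space) measure \<Rightarrow> 'a measure \<Rightarrow> ('a \<Rightarrow> 'a) \<Rightarrow> ('a \<times> 'a) measure" where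
  "coupling_measure \<mu>1 \<mu>2 T =
     measure_of UNIV (sets (borel \<Otimes>\<^sub>M borel))
       (\<lambda>C. \<integral>\<^sup>+ u. (\<integral>\<^sup>+ w.
              acceptance \<mu>1 \<mu>2 T w (T u) * emeasure (return borel (T u)) {v. (u, v) \<in> C}
            + (1 - acceptance \<mu>1 \<mu>2 T w (T u)) * emeasure (return borel w) {v. (u, v) \<in> C}
          \<partial>\<mu>2) \<partial>\<mu>1)"

end

theory Submission imports Defs begin

text \<open>
  Write \<open>\<nu>\<close> for the image of \<open>\<mu>1\<close> under \<open>T\<close> and \<open>f = d\<nu>/d\<mu>2\<close>. The measure is a
  Metropolis-Hastings step: \<open>u\<close> and \<open>w\<close> are drawn independently from \<open>\<mu>1\<close> and \<open>\<mu>2\<close>, and the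
  proposal \<open>T u\<close>, whose law is \<open>\<nu>\<close>, replaces \<open>w\<close> with probability \<open>\<beta> w (T u)\<close>. The first
  coordinate \<open>u\<close> is never changed, so the first marginal is \<open>\<mu>1\<close>.

  The second marginal rests on detailed balance. As \<open>\<nu> = f \<mu>2\<close> and \<open>d\<mu>2/d\<nu> = 1/f\<close> almost
  everywhere, the measure \<open>\<beta> w v \<mu>2(dw) \<nu>(dv)\<close> equals
  \<open>min (f v) (f w) \<mu>2(dw) \<mu>2(dv)\<close>, which is invariant under exchanging \<open>v\<close> and \<open>w\<close>. Hence the
  mass that acceptance moves into a set \<open>B\<close>, namely the integral of \<open>\<beta> w v\<close> over \<open>v \<in> B\<close>, is
  the integral of \<open>\<beta> w v\<close> over \<open>w \<in> B\<close>. Together with the integral of \<open>1 - \<beta> w v\<close> over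
  \<open>w \<in> B\<close> this gives exactly \<open>\<mu>2 B\<close>.
\<close>

lemma RN_deriv_mult_inverse:
  assumes "sigma_finite_measure M" and "sigma_finite_measure N"
    and "equivalent_measures N M"
  shows "AE x in M. RN_deriv M N x * RN_deriv N M x = 1"
proof -
  interpret M: sigma_finite_measure M by fact
  interpret N: sigma_finite_measure N by fact
  have sets: "sets N = sets M"
    and ac: "absolutely_continuous M N" "absolutely_continuous N M"
    using assms(3) by (auto simp: equivalent_measures_def)
  have [measurable]: "RN_deriv N M \<in> borel_measurable M"
    using borel_measurable_RN_deriv[of N M] measurable_cong_sets[OF sets refl] by blast
  have "density M (\<lambda>x. RN_deriv M N x * RN_deriv N M x) = density (density M (RN_deriv M N)) (RN_deriv N M)"
    by (simp add: density_density_eq)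
  also have "\<dots> = M"
    using M.density_RN_deriv[OF ac(1) sets] N.density_RN_deriv[OF ac(2)] sets by simp
  also have "\<dots> = density M (\<lambda>_. 1)"
    by (simp add: density_1)
  finally show ?thesis
    by (intro M.density_unique) auto
qed

text \<open>Detailed balance: \<open>f v * min 1 (f w * g v) = min (f v) (f w)\<close> whenever \<open>f v * g v = 1\<close>, and the
  right-hand side is symmetric, so Tonelli's theorem exchanges the roles of the variables.\<close>

lemma metropolis_detailed_balance:
  fixes \<phi> :: "'a \<Rightarrow> 'a \<Rightarrow> ennreal"
  assumes "sigma_finite_measure M" and "sigma_finite_measure N"
    and equiv: "equivalent_measures N M"
    and [measurable]: "case_prod \<phi> \<in> borel_measurable (M \<Otimes>\<^sub>M M)"
  shows "(\<integral>\<^sup>+ v. (\<integral>\<^sup>+ w. min 1 (RN_deriv M N w * RN_deriv N M v) * \<phi> w v \<partial>M) \<partial>N)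
       = (\<integral>\<^sup>+ v. (\<integral>\<^sup>+ w. min 1 (RN_deriv M N w * RN_deriv N M v) * \<phi> v w \<partial>M) \<partial>N)"
proof -
  interpret M: sigma_finite_measure M by fact
  interpret MM: pair_sigma_finite M M ..
  let ?f = "RN_deriv M N" and ?g = "RN_deriv N M"
  have sets: "sets N = sets M" and ac: "absolutely_continuous M N"
    using equiv by (auto simp: equivalent_measures_def)
  have [measurable]: "?g \<in> borel_measurable M"
    using borel_measurable_RN_deriv[of N M] measurable_cong_sets[OF sets refl] by blast
  have N: "N = density M ?f"
    using M.density_RN_deriv[OF ac sets] by simp
  have symmetrise: "(\<integral>\<^sup>+ v. (\<integral>\<^sup>+ w. min 1 (?f w * ?g v) * \<psi> w v \<partial>M) \<partial>N)
      = (\<integral>\<^sup>+ v. (\<integral>\<^sup>+ w. min (?f v) (?f w) * \<psi> w v \<partial>M) \<partial>M)"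
    if [measurable]: "case_prod \<psi> \<in> borel_measurable (M \<Otimes>\<^sub>M M)" for \<psi> :: "'a \<Rightarrow> 'a \<Rightarrow> ennreal"
  proof -
    have "(\<integral>\<^sup>+ v. (\<integral>\<^sup>+ w. min 1 (?f w * ?g v) * \<psi> w v \<partial>M) \<partial>N)
        = (\<integral>\<^sup>+ v. (\<integral>\<^sup>+ w. min 1 (?f w * ?g v) * \<psi> w v \<partial>M) \<partial>density M ?f)"
      by (rule arg_cong[OF N])
    also have "\<dots> = (\<integral>\<^sup>+ v. ?f v * (\<integral>\<^sup>+ w. min 1 (?f w * ?g v) * \<psi> w v \<partial>M) \<partial>M)"
      by (subst nn_integral_density) measurable
    also have "\<dots> = (\<integral>\<^sup>+ v. (\<integral>\<^sup>+ w. min (?f v) (?f w) * \<psi> w v \<partial>M) \<partial>M)"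
    proof (rule nn_integral_cong_AE)
      have "AE v in M. ?f v * ?g v = 1"
        using RN_deriv_mult_inverse assms by blast
      then show "AE v in M. ?f v * (\<integral>\<^sup>+ w. min 1 (?f w * ?g v) * \<psi> w v \<partial>M)
          = (\<integral>\<^sup>+ w. min (?f v) (?f w) * \<psi> w v \<partial>M)"
      proof (rule AE_mp, intro AE_I2 impI)
        fix v assume v [measurable]: "v \<in> space M" and inv: "?f v * ?g v = 1"
        have min: "?f v * min 1 (?f w * ?g v) = min (?f v) (?f w)" for w
        proof -
          have "?f v * min 1 (?f w * ?g v) = min (?f v * 1) (?f v * (?f w * ?g v))"
            by (intro min_of_mono[symmetric] monoI mult_left_mono) auto
          also have "?f v * (?f w * ?g v) = ?f w * (?f v * ?g v)"
            by (simp add: ac_simps)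
          finally show ?thesis by (simp add: inv)
        qed
        have "?f v * (\<integral>\<^sup>+ w. min 1 (?f w * ?g v) * \<psi> w v \<partial>M)
            = (\<integral>\<^sup>+ w. ?f v * (min 1 (?f w * ?g v) * \<psi> w v) \<partial>M)"
          by (subst nn_integral_cmult) measurable
        then show "?f v * (\<integral>\<^sup>+ w. min 1 (?f w * ?g v) * \<psi> w v \<partial>M)
            = (\<integral>\<^sup>+ w. min (?f v) (?f w) * \<psi> w v \<partial>M)"
          by (simp add: min flip: mult.assoc)
      qed
    qed
    finally show ?thesis .
  qed
  have "(\<integral>\<^sup>+ v. (\<integral>\<^sup>+ w. min (?f v) (?f w) * \<phi> w v \<partial>M) \<partial>M)
      = (\<integral>\<^sup>+ v. (\<integral>\<^sup>+ w. min (?f v) (?f w) * \<phi> v w \<partial>M) \<partial>M)"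
    by (subst MM.Fubini') (auto simp: min.commute)
  then show ?thesis
    by (simp add: symmetrise)
qed

lemma acceptance_measurable:
  fixes \<mu>1 \<mu>2 :: "('a::topological_space) measure"
  assumes [measurable_cong]: "sets \<mu>2 = sets borel"
  shows "(\<lambda>(w, v). acceptance \<mu>1 \<mu>2 T w v) \<in> borel_measurable (borel \<Otimes>\<^sub>M borel)"
proof -
  have [measurable]: "RN_deriv \<mu>2 (distr \<mu>1 borel T) \<in> borel_measurable borel"
    using borel_measurable_RN_deriv measurable_cong_sets[OF assms refl] by blast
  have [measurable]: "RN_deriv (distr \<mu>1 borel T) \<mu>2 \<in> borel_measurable borel"
    using borel_measurable_RN_deriv[of "distr \<mu>1 borel T" \<mu>2] by simp
  show ?thesis
    unfolding acceptance_def by measurable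
qed

lemma acceptance_le_1: "acceptance \<mu>1 \<mu>2 T w v \<le> 1"
  by (simp add: acceptance_def)

lemma sets_coupling_measure:
  "sets (coupling_measure \<mu>1 \<mu>2 T) = sets (borel \<Otimes>\<^sub>M borel)"
  unfolding coupling_measure_def
  using sets.sigma_sets_eq[of "borel \<Otimes>\<^sub>M borel"] by (simp add: space_pair_measure)

text \<open>The set function in the definition of the coupling is countably additive by monotone
  convergence, hence agrees on measurable sets with the measure it generates.\<close>

lemma emeasure_coupling_measure:
  fixes \<mu>1 \<mu>2 :: "('a::topological_space) measure"
  assumes "sigma_finite_measure \<mu>2"
    and [measurable_cong]: "sets \<mu>1 = sets borel" "sets \<mu>2 = sets borel"
    and [measurable]: "T \<in> borel_measurable borel"
    and C: "C \<in> sets (borel \<Otimes>\<^sub>M borel)"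
  shows "emeasure (coupling_measure \<mu>1 \<mu>2 T) C =
    (\<integral>\<^sup>+ u. (\<integral>\<^sup>+ w. acceptance \<mu>1 \<mu>2 T w (T u) * indicator C (u, T u)
                + (1 - acceptance \<mu>1 \<mu>2 T w (T u)) * indicator C (u, w) \<partial>\<mu>2) \<partial>\<mu>1)"
    (is "_ = ?F C")
proof -
  interpret \<mu>2: sigma_finite_measure \<mu>2 by fact
  let ?B = "borel \<Otimes>\<^sub>M borel :: ('a \<times> 'a) measure"
  note acceptance_measurable[OF assms(3), of \<mu>1 T, measurable]
  let ?G = "\<lambda>C. \<integral>\<^sup>+ u. (\<integral>\<^sup>+ w.
              acceptance \<mu>1 \<mu>2 T w (T u) * emeasure (return borel (T u)) {v. (u, v) \<in> C}
            + (1 - acceptance \<mu>1 \<mu>2 T w (T u)) * emeasure (return borel w) {v. (u, v) \<in> C}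
          \<partial>\<mu>2) \<partial>\<mu>1"
  have dirac: "emeasure (return borel x) {v. (u, v) \<in> D} = indicator D (u, x)"
    if "D \<in> sets ?B" for D and u x :: 'a
  proof -
    have "{v. (u, v) \<in> D} = Pair u -` D" by auto
    moreover have "Pair u -` D \<in> sets borel"
      using that by (rule sets_Pair1)
    ultimately show ?thesis by (simp add: indicator_def)
  qed
  have G: "?G D = ?F D" if "D \<in> sets ?B" for D
    using dirac[OF that] by simp
  have add: "countably_additive (sets ?B) ?G"
  proof (rule countably_additiveI)
    fix A :: "nat \<Rightarrow> ('a \<times> 'a) set"
    assume A: "range A \<subseteq> sets ?B" "disjoint_family A" "(\<Union>i. A i) \<in> sets ?B"
    have [measurable]: "A i \<in> sets ?B" for i using A(1) by auto
    have "(\<Sum>i. ?G (A i)) = (\<Sum>i. ?F (A i))"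
      by (intro suminf_cong G) measurable
    also have "\<dots> = (\<integral>\<^sup>+ u. (\<Sum>i. (\<integral>\<^sup>+ w. acceptance \<mu>1 \<mu>2 T w (T u) * indicator (A i) (u, T u)
        + (1 - acceptance \<mu>1 \<mu>2 T w (T u)) * indicator (A i) (u, w) \<partial>\<mu>2)) \<partial>\<mu>1)"
      by (subst nn_integral_suminf) measurable
    also have "\<dots> = (\<integral>\<^sup>+ u. (\<integral>\<^sup>+ w. (\<Sum>i. acceptance \<mu>1 \<mu>2 T w (T u) * indicator (A i) (u, T u)
        + (1 - acceptance \<mu>1 \<mu>2 T w (T u)) * indicator (A i) (u, w)) \<partial>\<mu>2) \<partial>\<mu>1)"
      by (subst nn_integral_suminf) measurable
    also have "\<dots> = ?F (\<Union>i. A i)"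
      by (simp add: suminf_add[OF summableI summableI, symmetric] suminf_indicator[OF A(2)])
    also have "\<dots> = ?G (\<Union>i. A i)"
      using G[OF A(3)] by simp
    finally show "(\<Sum>i. ?G (A i)) = ?G (\<Union>i. A i)" .
  qed
  have "sets (coupling_measure \<mu>1 \<mu>2 T) = sets ?B"
    by (rule sets_coupling_measure)
  then have "emeasure (coupling_measure \<mu>1 \<mu>2 T) C = ?G C"
    by (intro emeasure_measure_of[OF coupling_measure_def])
       (use C add in \<open>auto simp: positive_def\<close>)
  with G[OF C] show ?thesis by simp
qed

theorem proposition3p4:
  fixes \<mu>1 \<mu>2 :: "('a::polish_space) measure" and T :: "'a \<Rightarrow> 'a"
  assumes "prob_space \<mu>1" and "sets \<mu>1 = sets borel"
    and "prob_space \<mu>2" and "sets \<mu>2 = sets borel"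
    and "bij T" and "T \<in> borel_measurable borel"
    and "equivalent_measures (distr \<mu>1 borel T) \<mu>2"
  shows "coupling (coupling_measure \<mu>1 \<mu>2 T) \<mu>1 \<mu>2"
proof -
  interpret \<mu>1: prob_space \<mu>1 by fact
  interpret \<mu>2: prob_space \<mu>2 by fact
  note sets [measurable_cong] = assms(2,4)
  note T [measurable] = assms(6)
  note acceptance_measurable[OF assms(4), of \<mu>1 T, measurable]
  let ?P = "coupling_measure \<mu>1 \<mu>2 T" and ?\<nu> = "distr \<mu>1 borel T"
  let ?\<beta> = "acceptance \<mu>1 \<mu>2 T"
  interpret \<nu>: prob_space ?\<nu> by (rule \<mu>1.prob_space_distr) measurable
  note setsP [measurable_cong] = sets_coupling_measure[of \<mu>1 \<mu>2 T]
  have spaceP: "space ?P = UNIV" and space: "space \<mu>1 = UNIV" "space \<mu>2 = UNIV"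
    using sets_eq_imp_space_eq[OF setsP] sets_eq_imp_space_eq[OF sets(1)]
      sets_eq_imp_space_eq[OF sets(2)] by (auto simp: space_pair_measure)
  note emeasure_P = emeasure_coupling_measure[OF \<mu>2.sigma_finite_measure_axioms sets T]
  have complement: "?\<beta> w v * c + (1 - ?\<beta> w v) * c = c" for w v c
    using acceptance_le_1[of \<mu>1 \<mu>2 T w v] by (simp add: add_diff_inverse_ennreal flip: distrib_right)

  have fst_marginal: "distr ?P \<mu>1 fst = \<mu>1"
  proof (rule measure_eqI)
    fix A assume "A \<in> sets (distr ?P \<mu>1 fst)"
    then have [measurable]: "A \<in> sets borel" by (simp add: sets)
    have "emeasure (distr ?P \<mu>1 fst) A = emeasure ?P (A \<times> UNIV)"
      by (subst emeasure_distr) (auto simp: spaceP intro!: arg_cong[where f="emeasure ?P"])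
    also have "\<dots> = (\<integral>\<^sup>+ u. (\<integral>\<^sup>+ w. indicator A u \<partial>\<mu>2) \<partial>\<mu>1)"
      by (subst emeasure_P) (auto simp: indicator_times complement)
    also have "\<dots> = emeasure \<mu>1 A"
      by (simp add: \<mu>2.emeasure_space_1)
    finally show "emeasure (distr ?P \<mu>1 fst) A = emeasure \<mu>1 A" .
  qed simp

  have snd_marginal: "distr ?P \<mu>2 snd = \<mu>2"
  proof (rule measure_eqI)
    fix B assume "B \<in> sets (distr ?P \<mu>2 snd)"
    then have [measurable]: "B \<in> sets borel" by (simp add: sets)
    have balance: "(\<integral>\<^sup>+ v. (\<integral>\<^sup>+ w. ?\<beta> w v * indicator B v \<partial>\<mu>2) \<partial>?\<nu>)
        = (\<integral>\<^sup>+ v. (\<integral>\<^sup>+ w. ?\<beta> w v * indicator B w \<partial>\<mu>2) \<partial>?\<nu>)"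
      unfolding acceptance_def
      by (rule metropolis_detailed_balance[OF \<mu>2.sigma_finite_measure_axioms
            \<nu>.sigma_finite_measure_axioms assms(7), of "\<lambda>w v. indicator B v"]) measurable
    have "emeasure (distr ?P \<mu>2 snd) B = emeasure ?P (UNIV \<times> B)"
      by (subst emeasure_distr) (auto simp: spaceP intro!: arg_cong[where f="emeasure ?P"])
    also have "\<dots> = (\<integral>\<^sup>+ u. (\<integral>\<^sup>+ w. ?\<beta> w (T u) * indicator B (T u)
        + (1 - ?\<beta> w (T u)) * indicator B w \<partial>\<mu>2) \<partial>\<mu>1)"
      by (subst emeasure_P) (auto simp: indicator_times)
    also have "\<dots> = (\<integral>\<^sup>+ v. (\<integral>\<^sup>+ w. ?\<beta> w v * indicator B v
        + (1 - ?\<beta> w v) * indicator B w \<partial>\<mu>2) \<partial>?\<nu>)"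
      by (subst nn_integral_distr) measurable
    also have "\<dots> = (\<integral>\<^sup>+ v. (\<integral>\<^sup>+ w. ?\<beta> w v * indicator B v \<partial>\<mu>2) \<partial>?\<nu>)
        + (\<integral>\<^sup>+ v. (\<integral>\<^sup>+ w. (1 - ?\<beta> w v) * indicator B w \<partial>\<mu>2) \<partial>?\<nu>)"
      by (simp add: nn_integral_add)
    also have "\<dots> = (\<integral>\<^sup>+ v. (\<integral>\<^sup>+ w. ?\<beta> w v * indicator B w
        + (1 - ?\<beta> w v) * indicator B w \<partial>\<mu>2) \<partial>?\<nu>)"
      by (simp add: balance nn_integral_add)
    also have "\<dots> = emeasure \<mu>2 B"
      using \<nu>.emeasure_space_1 by (simp add: complement)
    finally show "emeasure (distr ?P \<mu>2 snd) B = emeasure \<mu>2 B" .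
  qed simp

  have "prob_space (distr ?P \<mu>1 fst)"
    unfolding fst_marginal by fact
  then have "prob_space ?P"
    by (rule prob_space_distrD[rotated]) measurable
  moreover have "sets ?P = sets (\<mu>1 \<Otimes>\<^sub>M \<mu>2)"
    using setsP sets_pair_measure_cong[OF sets] by simp
  ultimately show ?thesis
    using fst_marginal snd_marginal by (simp add: coupling_def)
qed

end
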